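(* Let $d\ge1$, let $S\subseteq \mathbb{N}_0^{d}$ be a generalized numerical semigroup, let $\mathbf{n}\in S$ with $\mathbf{n}\neq\mathbf{0}$, and let $\prec$ be a monomial order in $\mathbb{N}_0^{d}$. Then $S$ is almost symmetric with type $t$ if and only if it is possible to arrange the set $\operatorname{C}(S,\mathbf{n})$ in the following way $$\operatorname{C}(S,\mathbf{n})=\{\mathbf{a}_{0}=\mathbf{0}\prec\mathbf{a}_{1}\prec \cdots \prec \mathbf{a}_{m}\}\cup \{\mathbf{b}_{1}\prec \cdots \prec\mathbf{b}_{t-1} \},$$ with the following conditions: 1. $\mathbf{b}_{t-1}\prec \mathbf{a}_m$; 2. $\mathbf{b}_i-\mathbf{n} \in \mathbb{N}_0^d$ for every $i\in \{1,\ldots,t-1\}$; 3. $\mathbf{b}_i \nleq_{S} \mathbf{b}_j$ for every $i\neq j$; 4. $\mathbf{a}_{i}+\mathbf{a}_{m-i}=\mathbf{a}_{m}$ for all $i \in \{0,1,\ldots,m\}$; 5. $\mathbf{b}_{j}+\mathbf{b}_{t-j}=\mathbf{a}_{m}+\mathbf{n}$ for all $j \in \{1,\ldots,t-1\}$.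
   Context: $\mathbb{N}_0$ is the set of nonnegative integers. A generalized numerical semigroup (GNS) is a submonoid $S$ of $(\mathbb{N}_0^d,+)$ (closed under addition, containing $\mathbf{0}$) whose complement $\operatorname{H}(S)=\mathbb{N}_0^d\setminus S$ (the set of gaps) is finite. Its genus is $\operatorname{g}(S)=|\operatorname{H}(S)|$. Put $S^*=S\setminus\{\mathbf{0}\}$. The set of pseudo-Frobenius elements is $\operatorname{PF}(S)=\{\mathbf{h}\in\operatorname{H}(S)\mid \mathbf{h}+\mathbf{s}\in S\text{ for all }\mathbf{s}\in S^*\}$, and the type of $S$ is $\operatorname{t}(S)=|\operatorname{PF}(S)|$. For $\mathbf{x}=(x^{(1)},\dots,x^{(d)})\in\mathbb{N}_0^d$, $|\mathbf{x}|_\times=x^{(1)}\cdots x^{(d)}$, and $\mathbf{x}+\mathbf{1}$ is the vector with components $x^{(i)}+1$. $S$ is almost symmetric if $2\operatorname{g}(S)+1-\operatorname{t}(S)=|\mathbf{h}+\mathbf{1}|_\times$ for some $\mathbf{h}\in\operatorname{H}(S)$. On $\mathbb{Z}^d$: $\le$ is the componentwise partial order, and $\mathbf{y}\le_S\mathbf{x}$ means $\mathbf{x}-\mathbf{y}\in S$. For $\mathbf{n}\in S$, the Apéry set is $\operatorname{Ap}(S,\mathbf{n})=\{\mathbf{s}\in S\mid \mathbf{s}-\mathbf{n}\notin S\}$ (difference in $\mathbb{Z}^d$), and the reduced Apéry set is $\operatorname{C}(S,\mathbf{n})=\{\mathbf{s}\in\operatorname{Ap}(S,\mathbf{n})\mid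 \mathbf{s}\le\mathbf{h}+\mathbf{n}\text{ for some }\mathbf{h}\in\operatorname{H}(S)\}$. A monomial order on $\mathbb{N}_0^d$ is a (strict) total order $\prec$ such that $\mathbf{v}\prec\mathbf{w}$ implies $\mathbf{v}+\mathbf{u}\prec\mathbf{w}+\mathbf{u}$ for every $\mathbf{u}\in\mathbb{N}_0^d$, and $\mathbf{0}\prec\mathbf{v}$ for every $\mathbf{v}\neq\mathbf{0}$. Here $t\geq 1$ and $m\ge0$ are integers; the notation $\{\mathbf{a}_0\prec\cdots\prec\mathbf{a}_m\}$ means a set listed in increasing order; when $t=1$ the set of the $\mathbf{b}_i$ is empty and the conditions on the $\mathbf{b}_i$ are vacuous. *)

theory Defs
  imports "HOL-Analysis.Finite_Cartesian_Product"
begin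

text \<open>
  Elements of $N_0^d$ are vectors \<open>nat ^ 'd\<close>, where the arbitrary finite (nonempty) index type
  \<open>'d\<close> has \<open>d\<close> elements. Subtraction on \<open>nat ^ 'd\<close> truncates componentwise, so differences are
  formed in \<open>int ^ 'd\<close> after applying the following embedding.
\<close>

definition to_Z :: "nat ^ 'd \<Rightarrow> int ^ 'd" where
  "to_Z x = (\<chi> i. int (x $ i))"

definition gaps :: "(nat ^ 'd) set \<Rightarrow> (nat ^ 'd) set" where
  "gaps S = - S"

definition gns :: "(nat ^ 'd) set \<Rightarrow> bool" where
  "gns S \<longleftrightarrow> 0 \<in> S \<and> (\<forall>x\<in>S. \<forall>y\<in>S. x + y \<in> S) \<and> finite (gaps S)"

definition genus :: "(nat ^ 'd) set \<Rightarrow> nat" where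
  "genus S = card (gaps S)"

definition pseudo_frobenius :: "(nat ^ 'd) set \<Rightarrow> (nat ^ 'd) set" where
  "pseudo_frobenius S = {h \<in> gaps S. \<forall>s \<in> S - {0}. h + s \<in> S}"

definition gns_type :: "(nat ^ 'd) set \<Rightarrow> nat" where
  "gns_type S = card (pseudo_frobenius S)"

definition comp_prod :: "nat ^ 'd \<Rightarrow> nat" where
  "comp_prod x = (\<Prod>i\<in>UNIV. x $ i)"

text \<open>Here \<open>1 :: nat ^ 'd\<close> is the all-ones vector.\<close>

definition almost_symmetric :: "(nat ^ 'd) set \<Rightarrow> bool" where
  "almost_symmetric S \<longleftrightarrow>
     (\<exists>h \<in> gaps S. 2 * int (genus S) + 1 - int (gns_type S) = int (comp_prod (h + 1)))"

text \<open>\<open>le_sg S y x\<close> is the relation $y \le_S x$ on $Z^d$.\<close>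

definition le_sg :: "(nat ^ 'd) set \<Rightarrow> int ^ 'd \<Rightarrow> int ^ 'd \<Rightarrow> bool" where
  "le_sg S y x \<longleftrightarrow> x - y \<in> to_Z ` S"

definition apery :: "(nat ^ 'd) set \<Rightarrow> nat ^ 'd \<Rightarrow> (nat ^ 'd) set" where
  "apery S n = {s \<in> S. to_Z s - to_Z n \<notin> to_Z ` S}"

definition reduced_apery :: "(nat ^ 'd) set \<Rightarrow> nat ^ 'd \<Rightarrow> (nat ^ 'd) set" where
  "reduced_apery S n = {s \<in> apery S n. \<exists>h \<in> gaps S. s \<le> h + n}"

definition monomial_order :: "(nat ^ 'd \<Rightarrow> nat ^ 'd \<Rightarrow> bool) \<Rightarrow> bool" where
  "monomial_order prec \<longleftrightarrow>
     irreflp prec \<and> transp prec \<and> totalp prec \<and>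
     (\<forall>v w u. prec v w \<longrightarrow> prec (v + u) (w + u)) \<and>
     (\<forall>v. v \<noteq> 0 \<longrightarrow> prec 0 v)"

end

theory Submission
  imports Defs
begin

text \<open>
  The equivalence goes through a description of almost symmetry by a reflection. Fix a gap \<open>h\<close> and
  compare a gap \<open>x\<close> with \<open>h - x\<close>. The box of all \<open>x \<le> h\<close> has \<open>|h + 1|\<^sub>\<times>\<close> points; it
  contains, for every gap \<open>x\<close> with \<open>h - x \<in> S\<close>, both \<open>x\<close> and \<open>h - x\<close>, and otherwise only those
  gaps \<open>x \<le> h\<close> with \<open>h - x \<notin> S\<close>. Hence \<open>2 g(S) - |h + 1|\<^sub>\<times>\<close> counts the gaps \<open>x\<close> with
  \<open>h - x \<notin> S\<close>, those not below \<open>h\<close> twice. All pseudo-Frobenius elements other than \<open>h\<close> are such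
  gaps, so \<open>2 g(S) - |h + 1|\<^sub>\<times>\<close> is at least \<open>t(S) - 1\<close>, with equality exactly when all gaps lie below
  \<open>h\<close> and every gap \<open>x\<close> with \<open>h - x \<notin> S\<close> is pseudo-Frobenius
  (\<open>almost_symmetric_iff_reflecting_gap\<close>).

  In that situation \<open>x \<mapsto> h - x\<close> is an involution of \<open>PF(S) - {h}\<close>, and \<open>c \<mapsto> h + n - c\<close> is
  an involution of the elements of the reduced Apery set that are not of the form \<open>f + n\<close> with
  \<open>f \<in> PF(S) - {h}\<close>. These two parts are the \<open>b\<close>'s and the \<open>a\<close>'s. Both involutions reverse
  the monomial order, so they act on increasing enumerations by reversing the indices; this is
  \<open>increasing_enumeration_reflects\<close>, and it turns conditions 4 and 5 into statements about sets.

  Conversely, from an arrangement one finds \<open>a\<^sub>m = h + n\<close>, where \<open>h\<close> is the largest gap in the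
  monomial order. Starting from any gap \<open>x\<close> and adding \<open>n\<close> until the result lies in \<open>S\<close>, one
  arrives at an element of the reduced Apery set; its place in the arrangement shows that
  \<open>h - x \<in> S\<close> or that \<open>x\<close> is one of the \<open>b\<^sub>i - n\<close>. The incomparability of the \<open>b\<close>'s makes the
  \<open>b\<^sub>i - n\<close> pseudo-Frobenius (\<open>reflecting_gap_of_reduced_apery_cover\<close>).
\<close>

section \<open>Vectors of natural numbers\<close>

lemma vec_le_iff_add: "x \<le> y \<longleftrightarrow> (\<exists>z. y = x + z)" for x y :: "nat ^ 'd"
proof
  assume "x \<le> y"
  then have "y = x + (\<chi> i. y $ i - x $ i)"
    by (auto simp: less_eq_vec_def vec_eq_iff)
  then show "\<exists>z. y = x + z" ..
qed (auto simp: less_eq_vec_def)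

lemma vec_le_add: "x \<le> x + z" for x z :: "nat ^ 'd"
  by (auto simp: vec_le_iff_add)

lemma vec_add_le_self_iff: "x + z \<le> x \<longleftrightarrow> z = 0" for x z :: "nat ^ 'd"
  by (auto simp: less_eq_vec_def vec_eq_iff)

lemma vec_add_right_le_iff: "x + z \<le> y + z \<longleftrightarrow> x \<le> y" for x y z :: "nat ^ 'd"
  by (auto simp: less_eq_vec_def)

lemma vec_add_eq_0_iff: "x + z = 0 \<longleftrightarrow> x = 0 \<and> z = 0" for x z :: "nat ^ 'd"
  by (auto simp: vec_eq_iff)

lemma vec_atMost_eq_image: "{..h} = vec_lambda ` (PiE UNIV (\<lambda>i. {..h $ i}))" for h :: "nat ^ 'd"
proof -
  have "x \<in> vec_lambda ` (PiE UNIV (\<lambda>i. {..h $ i}))" if "x \<le> h" for x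
    by (rule image_eqI[of _ _ "vec_nth x"]) (use that in \<open>auto simp: less_eq_vec_def\<close>)
  then show ?thesis
    by (auto simp: less_eq_vec_def PiE_iff)
qed

lemma finite_vec_atMost: "finite {..h}" for h :: "nat ^ 'd"
  unfolding vec_atMost_eq_image by (intro finite_imageI finite_PiE) auto

lemma card_vec_atMost: "card {..h} = comp_prod (h + 1)" for h :: "nat ^ 'd"
proof -
  have "card {..h} = card (PiE (UNIV :: 'd set) (\<lambda>i. {..h $ i}))"
    unfolding vec_atMost_eq_image by (rule card_image) (auto intro!: inj_onI simp: vec_lambda_inject)
  also have "\<dots> = (\<Prod>i\<in>UNIV. card {..h $ i})"
    by (rule card_PiE) auto
  finally show ?thesis
    by (simp add: comp_prod_def)
qed

lemma to_Z_diff_mem_image_iff: "to_Z x - to_Z y \<in> to_Z ` T \<longleftrightarrow> (\<exists>u\<in>T. x = u + y)"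
  for x y :: "nat ^ 'd"
proof -
  have "to_Z x - to_Z y = to_Z u \<longleftrightarrow> x = u + y" for u
    by (auto simp: vec_eq_iff to_Z_def algebra_simps simp flip: of_nat_add)
  then show ?thesis
    by (auto simp: image_iff)
qed


section \<open>Increasing enumerations in a monomial order\<close>

context
  fixes prec :: "nat ^ 'd \<Rightarrow> nat ^ 'd \<Rightarrow> bool"  (infix "\<prec>" 50)
  assumes monomial: "monomial_order (\<prec>)"
begin

lemma prec_linorder: "class.linorder (\<lambda>x y. x \<prec> y \<or> x = y) (\<prec>)"
  using monomial unfolding monomial_order_def
  by unfold_locales (blast dest: irreflpD transpD totalpD)+

lemma prec_irrefl: "\<not> x \<prec> x"
  using monomial by (auto simp: monomial_order_def dest: irreflpD)

lemma prec_trans: "x \<prec> y \<Longrightarrow> y \<prec> z \<Longrightarrow> x \<prec> z"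
  using monomial by (auto simp: monomial_order_def dest: transpD)

lemma prec_cases: "x \<prec> y \<or> x = y \<or> y \<prec> x"
  using monomial by (auto simp: monomial_order_def dest: totalpD)

lemma prec_add_right: "x \<prec> y \<Longrightarrow> x + z \<prec> y + z"
  using monomial by (auto simp: monomial_order_def)

lemma zero_prec: "x \<noteq> 0 \<Longrightarrow> 0 \<prec> x"
  using monomial by (auto simp: monomial_order_def)

text \<open>A monomial order refines the componentwise order.\<close>

lemma prec_of_le: "x \<le> y \<Longrightarrow> x \<prec> y \<or> x = y"
  by (metis add_0 add.commute prec_add_right vec_le_iff_add zero_prec)

lemma ex_prec_maximum:
  assumes "finite A" "A \<noteq> {}"
  shows "\<exists>x\<in>A. \<forall>y\<in>A. y \<prec> x \<or> y = x"
  using assms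
proof (induction A rule: finite_ne_induct)
  case (insert x A)
  then obtain z where z: "z \<in> A" "\<forall>y\<in>A. y \<prec> z \<or> y = z"
    by blast
  show ?case
  proof (cases "z \<prec> x")
    case True
    then show ?thesis
      using z(2) prec_trans by blast
  next
    case False
    then show ?thesis
      using z prec_cases[of z x] by blast
  qed
qed simp

lemma ex_increasing_enumeration:
  assumes "finite A"
  shows "\<exists>e. e ` {..<card A} = A \<and> monotone_on {..<card A} (<) (\<prec>) e"
proof -
  interpret linorder "\<lambda>x y. x \<prec> y \<or> x = y" "(\<prec>)"
    by (rule prec_linorder)
  show ?thesis
    using assms
  proof (induction A rule: finite_linorder_max_induct)
    case empty
    then show ?case by (auto simp: monotone_on_def)
  next
    case (insert y A)
    then obtain e where e: "e ` {..<card A} = A" "monotone_on {..<card A} (<) (\<prec>) e"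
      by blast
    have "y \<notin> A"
      using insert.hyps(2) prec_irrefl by blast
    then have card: "card (insert y A) = Suc (card A)"
      using insert.hyps(1) by simp
    have mem: "e i \<in> A" if "i < card A" for i
      using e(1) that by blast
    have "(e(card A := y)) ` {..<Suc (card A)} = insert y A"
      by (subst lessThan_Suc) (use e(1) in \<open>auto simp: image_iff\<close>)
    moreover have "monotone_on {..<Suc (card A)} (<) (\<prec>) (e(card A := y))"
      using e(2) insert.hyps(2) mem by (auto simp: monotone_on_def less_Suc_eq)
    ultimately show ?case
      unfolding card by blast
  qed
qed

lemma monotone_on_imp_inj_on:
  fixes I :: "nat set"
  assumes "monotone_on I (<) (\<prec>) e"
  shows "inj_on e I"
proof (rule inj_onI)
  fix i j assume "i \<in> I" "j \<in> I" "e i = e j"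
  then show "i = j"
    using assms prec_irrefl by (metis monotone_onD nat_neq_iff)
qed

text \<open>
  The map \<open>i \<mapsto> p i\<close> induced on indices by the involution \<open>x \<mapsto> c - x\<close> is strictly decreasing,
  because \<open>e i\<close> and \<open>e (p i)\<close> cannot both grow while their sum stays \<open>c\<close>. A strictly decreasing
  map from an initial segment of the natural numbers to itself reverses it.
\<close>

lemma increasing_enumeration_reflects:
  assumes img: "e ` {..<k} = A"
    and mono: "monotone_on {..<k} (<) (\<prec>) e"
    and refl: "\<And>x. x \<in> A \<Longrightarrow> \<exists>y\<in>A. x + y = c"
    and "i < k"
  shows "e i + e (k - Suc i) = c"
proof -
  have "\<exists>j<k. e i + e j = c" if "i < k" for i
    using refl[of "e i"] that unfolding img[symmetric] by auto
  then obtain p where p: "p i < k" "e i + e (p i) = c" if "i < k" for i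
    by metis
  have decr: "p j < p i" if "i < j" "j < k" for i j
  proof (rule ccontr)
    assume "\<not> p j < p i"
    have ij: "e i \<prec> e j"
      using that mono by (auto simp: monotone_on_def)
    have "p i < k" "p j < k"
      using p(1) that by auto
    then have pij: "e (p i) \<prec> e (p j) \<or> e (p i) = e (p j)"
      using \<open>\<not> p j < p i\<close> mono by (cases "p i = p j") (auto simp: monotone_on_def)
    have "e i + e (p i) \<prec> e j + e (p i)"
      using ij by (rule prec_add_right)
    moreover have "e j + e (p i) \<prec> e j + e (p j) \<or> e j + e (p i) = e j + e (p j)"
      using pij prec_add_right[of "e (p i)" "e (p j)" "e j"] by (auto simp: add.commute)
    ultimately have "e i + e (p i) \<prec> e j + e (p j)"
      using prec_trans by metis
    then show False
      using p(2)[of i] p(2)[of j] that prec_irrefl by simp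
  qed
  have upper: "i + p i < k" if "i < k" for i
    using that
  proof (induction i)
    case 0
    then show ?case using p(1) by simp
  next
    case (Suc i)
    then show ?case using decr[of i "Suc i"] by simp
  qed
  have lower: "k \<le> Suc (i + p i)" if "i < k" for i
  proof -
    have "i \<le> k - 1"
      using that by simp
    then show ?thesis
    proof (induction rule: inc_induct)
      case base
      then show ?case by simp
    next
      case (step j)
      then have "Suc j < k"
        by linarith
      then have "p (Suc j) < p j"
        by (intro decr) simp_all
      then show ?case
        using step.IH by linarith
    qed
  qed
  have "p i = k - Suc i"
    using upper[OF \<open>i < k\<close>] lower[OF \<open>i < k\<close>] by simp
  then show ?thesis
    using p(2)[OF \<open>i < k\<close>] by simp
qed

end


section \<open>Almost symmetry as a reflection of the gaps\<close>

lemma gns_zero: "gns S \<Longrightarrow> 0 \<in> S"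
  and gns_add: "gns S \<Longrightarrow> x \<in> S \<Longrightarrow> y \<in> S \<Longrightarrow> x + y \<in> S"
  and gns_finite_gaps: "gns S \<Longrightarrow> finite (gaps S)"
  by (auto simp: gns_def)

text \<open>The gaps \<open>x\<close> with \<open>h - x \<notin> S\<close>, where the difference may have negative components.\<close>

definition unpaired_gaps :: "(nat ^ 'd) set \<Rightarrow> nat ^ 'd \<Rightarrow> (nat ^ 'd) set" where
  "unpaired_gaps S h = {x \<in> gaps S. \<forall>s\<in>S. x + s \<noteq> h}"

lemma pseudo_frobenius_subset_unpaired:
  assumes "h \<in> gaps S"
  shows "pseudo_frobenius S - {h} \<subseteq> unpaired_gaps S h"
proof
  fix f assume f: "f \<in> pseudo_frobenius S - {h}"
  have "f + s \<noteq> h" if "s \<in> S" for s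
    using f that assms by (cases "s = 0") (auto simp: pseudo_frobenius_def gaps_def)
  then show "f \<in> unpaired_gaps S h"
    using f by (auto simp: unpaired_gaps_def pseudo_frobenius_def)
qed

text \<open>
  For a gap \<open>h\<close> the map \<open>x \<mapsto> h - x\<close> matches the elements of \<open>S\<close> below \<open>h\<close> with the paired gaps,
  so the box below \<open>h\<close> contains two points for each paired gap.
\<close>

lemma double_genus_eq:
  assumes "gns S" "h \<in> gaps S"
  shows "2 * genus S =
    comp_prod (h + 1) + card (unpaired_gaps S h) + card (unpaired_gaps S h - {..h})"
proof -
  define P where "P = gaps S - unpaired_gaps S h"
  define B where "B = S \<inter> {..h}"
  define L where "L = unpaired_gaps S h"
  have fin: "finite (gaps S)" "finite L" "finite P" "finite B"
    using gns_finite_gaps[OF assms(1)] finite_vec_atMost[of h]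
    by (auto simp: P_def L_def B_def unpaired_gaps_def)
  have P_iff: "x \<in> P \<longleftrightarrow> x \<in> gaps S \<and> (\<exists>s\<in>S. x + s = h)" for x
    by (auto simp: P_def unpaired_gaps_def)
  have gap: "x \<notin> S" if "x + s = h" "s \<in> S" for x s
    using gns_add[OF assms(1)] that assms(2) by (auto simp: gaps_def)
  have "bij_betw (\<lambda>x. h - x) B P"
  proof (rule bij_betw_byWitness[where f' = "\<lambda>x. h - x"])
    have "h - (h - x) = x" if "h = x + z" for x z
      unfolding that by (simp only: add_diff_cancel_left' add_diff_cancel_right')
    then show "\<forall>x\<in>B. h - (h - x) = x" "\<forall>x\<in>P. h - (h - x) = x"
      by (auto simp only: B_def P_iff vec_le_iff_add Int_iff atMost_iff)
    show "(\<lambda>x. h - x) ` B \<subseteq> P"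
    proof (intro image_subsetI)
      fix x assume "x \<in> B"
      then obtain z where "h = x + z" "x \<in> S"
        by (auto simp: B_def vec_le_iff_add)
      then show "h - x \<in> P"
        using gap[of z x] by (auto simp: P_iff gaps_def add.commute)
    qed
    show "(\<lambda>x. h - x) ` P \<subseteq> B"
    proof (intro image_subsetI)
      fix x assume "x \<in> P"
      then obtain s where "s \<in> S" "h = x + s"
        by (auto simp: P_iff)
      then show "h - x \<in> B"
        using vec_le_add[of s x] by (simp add: B_def add.commute)
    qed
  qed
  then have "card P = card B"
    by (metis bij_betw_same_card)
  moreover have "genus S = card P + card L"
  proof -
    have "gaps S = P \<union> L" "P \<inter> L = {}"
      by (auto simp: P_def L_def unpaired_gaps_def)
    then show ?thesis
      using fin by (simp add: genus_def card_Un_disjoint)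
  qed
  moreover have "comp_prod (h + 1) = card B + card P + card (L \<inter> {..h})"
  proof -
    have "P \<subseteq> {..h}"
      by (auto simp: P_iff vec_le_iff_add)
    then have "{..h} = B \<union> P \<union> (L \<inter> {..h})"
      by (auto simp: B_def P_def L_def gaps_def)
    moreover have "B \<inter> P = {}" "(B \<union> P) \<inter> (L \<inter> {..h}) = {}"
      by (auto simp: B_def P_def L_def unpaired_gaps_def gaps_def)
    ultimately show ?thesis
      using fin by (metis card_Un_disjoint card_vec_atMost finite_Int finite_UnI)
  qed
  moreover have "card L = card (L \<inter> {..h}) + card (L - {..h})"
    using fin by (metis card_Int_Diff)
  ultimately show ?thesis
    by (simp add: L_def)
qed

text \<open>
  Every gap is reflected at \<open>h\<close> into \<open>S\<close>, unless it is pseudo-Frobenius. Such an \<open>h\<close> is the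
  maximum of all gaps.
\<close>

definition reflecting_gap :: "(nat ^ 'd) set \<Rightarrow> nat ^ 'd \<Rightarrow> bool" where
  "reflecting_gap S h \<longleftrightarrow> h \<in> gaps S \<and>
     (\<forall>x\<in>gaps S. x \<le> h \<and> ((\<exists>s\<in>S. x + s = h) \<or> x \<in> pseudo_frobenius S))"

lemma maximum_gap_pseudo_frobenius:
  assumes "h \<in> gaps S" "\<And>x. x \<in> gaps S \<Longrightarrow> x \<le> h"
  shows "h \<in> pseudo_frobenius S"
  using assms vec_add_le_self_iff by (auto simp: pseudo_frobenius_def gaps_def)

text \<open>
  By \<open>double_genus_eq\<close>, the defining equation of almost symmetry at \<open>h\<close> says that the unpaired gaps,
  those outside the box counted twice, are as many as \<open>t(S) - 1\<close>. As they contain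
  \<open>PF(S) - {h}\<close>, this is the least possible number, and attaining it forces \<open>h \<in> PF(S)\<close>, equality
  of the two sets and the absence of unpaired gaps outside the box.
\<close>

lemma almost_symmetric_iff_reflecting_gap:
  assumes "gns S"
  shows "almost_symmetric S \<longleftrightarrow> (\<exists>h. reflecting_gap S h)"
proof -
  have "2 * int (genus S) + 1 - int (gns_type S) = int (comp_prod (h + 1)) \<longleftrightarrow> reflecting_gap S h"
    if h: "h \<in> gaps S" for h
  proof -
    let ?L = "unpaired_gaps S h" and ?PF = "pseudo_frobenius S"
    have fin: "finite ?L" "finite ?PF"
      using gns_finite_gaps[OF assms] by (auto simp: unpaired_gaps_def pseudo_frobenius_def)
    have sub: "?PF - {h} \<subseteq> ?L"
      using pseudo_frobenius_subset_unpaired[OF h] .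
    have h_paired: "h \<notin> ?L"
      using gns_zero[OF assms] by (auto simp: unpaired_gaps_def)
    have "2 * int (genus S) + 1 - int (gns_type S) = int (comp_prod (h + 1)) \<longleftrightarrow>
        card ?L + card (?L - {..h}) + 1 = card ?PF"
      using double_genus_eq[OF assms h] by (auto simp: gns_type_def)
    also have "\<dots> \<longleftrightarrow> h \<in> ?PF \<and> ?L = ?PF - {h} \<and> ?L \<subseteq> {..h}"
    proof
      assume eq: "card ?L + card (?L - {..h}) + 1 = card ?PF"
      have "h \<in> ?PF"
        using card_mono[OF fin(1) sub] eq by (cases "h \<in> ?PF") auto
      then have "card ?PF = card (?PF - {h}) + 1"
        using fin(2) by (metis Suc_eq_plus1 card_Suc_Diff1)
      then have "card ?L + card (?L - {..h}) = card (?PF - {h})"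
        using eq by simp
      then have "card (?PF - {h}) = card ?L" "card (?L - {..h}) = 0"
        using card_mono[OF fin(1) sub] by linarith+
      then have "?L = ?PF - {h}" "?L - {..h} = {}"
        using card_subset_eq[OF fin(1) sub] fin(1) by simp_all
      then show "h \<in> ?PF \<and> ?L = ?PF - {h} \<and> ?L \<subseteq> {..h}"
        using \<open>h \<in> ?PF\<close> by blast
    next
      assume *: "h \<in> ?PF \<and> ?L = ?PF - {h} \<and> ?L \<subseteq> {..h}"
      then have "?L - {..h} = {}"
        by blast
      then have "card (?L - {..h}) = 0"
        by (simp only: card.empty)
      moreover have "card ?PF = card ?L + 1"
        using * fin(2) by (metis Suc_eq_plus1 card_Suc_Diff1)
      ultimately show "card ?L + card (?L - {..h}) + 1 = card ?PF"
        by linarith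
    qed
    also have "\<dots> \<longleftrightarrow> reflecting_gap S h"
    proof
      assume *: "h \<in> ?PF \<and> ?L = ?PF - {h} \<and> ?L \<subseteq> {..h}"
      have "x \<le> h \<and> ((\<exists>s\<in>S. x + s = h) \<or> x \<in> ?PF)" if "x \<in> gaps S" for x
      proof (cases "x \<in> ?L")
        case True
        then show ?thesis using * by blast
      next
        case False
        then obtain s where "s \<in> S" "x + s = h"
          using \<open>x \<in> gaps S\<close> by (auto simp: unpaired_gaps_def)
        then show ?thesis
          using vec_le_add by blast
      qed
      then show "reflecting_gap S h"
        using h by (simp add: reflecting_gap_def)
    next
      assume refl: "reflecting_gap S h"
      then have "h \<in> ?PF"
        using maximum_gap_pseudo_frobenius[OF h] by (simp add: reflecting_gap_def)
      moreover have "?L \<subseteq> ?PF" "?L \<subseteq> {..h}"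
        using refl unfolding reflecting_gap_def unpaired_gaps_def by blast+
      ultimately show "h \<in> ?PF \<and> ?L = ?PF - {h} \<and> ?L \<subseteq> {..h}"
        using sub h_paired by blast
    qed
    finally show ?thesis .
  qed
  then show ?thesis
    by (auto simp: almost_symmetric_def reflecting_gap_def)
qed


section \<open>The reduced Apery set\<close>

lemma reduced_apery_iff:
  "c \<in> reduced_apery S n \<longleftrightarrow>
    c \<in> S \<and> (\<forall>u\<in>S. c \<noteq> u + n) \<and> (\<exists>h\<in>gaps S. c \<le> h + n)"
  by (auto simp: reduced_apery_def apery_def to_Z_diff_mem_image_iff)

lemma gap_add_mem_reduced_apery:
  assumes "x \<in> gaps S" "x + n \<in> S"
  shows "x + n \<in> reduced_apery S n"
  using assms by (auto simp: reduced_apery_iff gaps_def)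

lemma reflecting_gap_reduced_apery_iff:
  assumes "reflecting_gap S h"
  shows "c \<in> reduced_apery S n \<longleftrightarrow> c \<in> S \<and> (\<forall>u\<in>S. c \<noteq> u + n) \<and> c \<le> h + n"
proof -
  have "c \<le> h + n" if "x \<in> gaps S" "c \<le> x + n" for x
  proof -
    have "x + n \<le> h + n"
      using that(1) assms by (simp add: reflecting_gap_def vec_add_right_le_iff)
    then show ?thesis
      using that(2) by (rule order_trans[rotated])
  qed
  then show ?thesis
    using assms unfolding reduced_apery_iff reflecting_gap_def by blast
qed

text \<open>
  If \<open>f \<noteq> h\<close> is pseudo-Frobenius, then \<open>h - f\<close> is a gap, as otherwise \<open>f + (h - f)\<close> would lie in
  \<open>S\<close>. Its own reflection \<open>f\<close> is a gap too, which leaves only that \<open>h - f\<close> is pseudo-Frobenius.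
\<close>

lemma reflecting_gap_reflects_pseudo_frobenius:
  assumes "gns S" "reflecting_gap S h" "f \<in> pseudo_frobenius S - {h}"
  shows "\<exists>g \<in> pseudo_frobenius S - {h}. f + g = h"
proof -
  have "f \<le> h"
    using assms(2,3) by (auto simp: reflecting_gap_def pseudo_frobenius_def)
  then obtain g where g: "h = f + g"
    by (auto simp: vec_le_iff_add)
  have "f \<in> unpaired_gaps S h"
    using assms pseudo_frobenius_subset_unpaired by (auto simp: reflecting_gap_def)
  then have "g \<in> gaps S" "f \<in> gaps S"
    using g by (auto simp: unpaired_gaps_def gaps_def)
  moreover have "\<not> (\<exists>s\<in>S. g + s = h)"
    using g \<open>f \<in> gaps S\<close> by (auto simp: gaps_def add.commute)
  ultimately have "g \<in> pseudo_frobenius S"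
    using assms(2) by (auto simp: reflecting_gap_def)
  moreover have "g \<noteq> h"
    using g \<open>f \<in> gaps S\<close> gns_zero[OF assms(1)] by (auto simp: gaps_def)
  ultimately show ?thesis
    using g by blast
qed

text \<open>
  Put \<open>d = h + n - c\<close>. If \<open>d\<close> were a gap, its reflection \<open>h - d = c - n\<close> would be a gap as well, so
  that both would belong to \<open>F\<close> and \<open>c\<close> to the excluded part. That \<open>d - n = h - c\<close> is not in \<open>S\<close>
  follows from \<open>c \<in> S\<close>.
\<close>

lemma reflecting_gap_reflects_reduced_apery:
  assumes "gns S" "reflecting_gap S h" "n \<in> S"
    and F: "F = pseudo_frobenius S - {h}"
    and c: "c \<in> reduced_apery S n - (\<lambda>f. f + n) ` F"
  shows "\<exists>c' \<in> reduced_apery S n - (\<lambda>f. f + n) ` F. c + c' = h + n"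
proof -
  have c': "c \<in> S" "\<And>u. u \<in> S \<Longrightarrow> c \<noteq> u + n" "c \<le> h + n"
    using c assms(2) by (auto simp: reflecting_gap_reduced_apery_iff)
  then obtain d where d: "h + n = c + d"
    by (auto simp: vec_le_iff_add)
  have d_F: "d \<noteq> f + n" if f: "f \<in> F" for f
  proof
    assume "d = f + n"
    then have "h = c + f"
      using d by (simp add: add.assoc[symmetric])
    moreover obtain g where "g \<in> F" "f + g = h"
      using reflecting_gap_reflects_pseudo_frobenius[OF assms(1,2)] f F by blast
    ultimately have "f + g = f + c" "g \<in> F"
      by (simp_all add: add.commute)
    then have "c \<in> F"
      by simp
    then show False
      using c'(1) by (simp add: F pseudo_frobenius_def gaps_def)
  qed
  have d_S: "d \<in> S"
  proof (rule ccontr)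
    assume "d \<notin> S"
    then have gap: "d \<in> gaps S"
      by (simp add: gaps_def)
    then obtain g where g: "h = d + g"
      using assms(2) by (auto simp: reflecting_gap_def vec_le_iff_add)
    have "d + c = h + n"
      by (simp only: d add.commute)
    also have "\<dots> = d + (g + n)"
      by (simp only: g add.assoc)
    finally have cg: "c = g + n"
      by simp
    then have "g \<notin> S"
      using c'(2) by blast
    then have "d \<in> F"
      using gap g assms(2) gns_zero[OF assms(1)] by (auto simp: reflecting_gap_def F)
    then obtain g' where "g' \<in> F" "d + g' = h"
      using reflecting_gap_reflects_pseudo_frobenius[OF assms(1,2)] F by blast
    then show False
      using g cg c by auto
  qed
  have "d \<noteq> u + n" if "u \<in> S" for u
  proof
    assume "d = u + n"
    then have "h = c + u"
      using d by (simp add: add.assoc[symmetric])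
    then show False
      using that c'(1) gns_add[OF assms(1)] assms(2) by (auto simp: reflecting_gap_def gaps_def)
  qed
  moreover have "d \<le> h + n"
    unfolding d using vec_le_add[of d c] by (simp only: add.commute)
  ultimately have "d \<in> reduced_apery S n"
    using d_S assms(2) by (simp add: reflecting_gap_reduced_apery_iff)
  moreover have "d \<notin> (\<lambda>f. f + n) ` F"
    using d_F by blast
  ultimately show ?thesis
    using d by (intro bexI[of _ d]) simp_all
qed

text \<open>
  A set \<open>F\<close> covering part of the reduced Apery set plays the role of the vectors \<open>b\<^sub>i - n\<close> here,
  and \<open>h\<close> that of \<open>a\<^sub>m - n\<close>. The main point is that each gap \<open>x\<close> has \<open>h - x \<in> S\<close> or lies in \<open>F\<close>:
  this is inherited from \<open>x + n\<close> if \<open>x + n\<close> is still a gap, because \<open>g + n \<in> S\<close> for all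
  \<open>g \<in> F\<close>, and is read off from the covering if \<open>x + n \<in> S\<close>.
\<close>

lemma reflecting_gap_of_reduced_apery_cover:
  assumes gns: "gns S" and n: "n \<in> S" "n \<noteq> 0" and h: "h \<in> gaps S"
    and cover: "\<And>c. c \<in> reduced_apery S n \<Longrightarrow> (\<exists>s\<in>S. c + s = h + n) \<or> (\<exists>f\<in>F. c = f + n)"
    and gaps_F: "F \<subseteq> gaps S"
    and F_add: "\<And>f. f \<in> F \<Longrightarrow> f + n \<in> S"
    and refl_F: "\<And>f. f \<in> F \<Longrightarrow> \<exists>g\<in>F. f + g = h"
    and incomparable: "\<And>f s. f \<in> F \<Longrightarrow> s \<in> S \<Longrightarrow> f + s \<in> F \<Longrightarrow> s = 0"
  shows "reflecting_gap S h" "pseudo_frobenius S = insert h F" "h \<notin> F"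
proof -
  have dichotomy: "(\<exists>s\<in>S. x + s = h) \<or> x \<in> F" if "x \<in> gaps S" for x
    using that
  proof (induction x rule: measure_induct_rule[of "\<lambda>x. card {y \<in> gaps S. x \<le> y}"])
    case (less x)
    show ?case
    proof (cases "x + n \<in> S")
      case True
      have "x + n + s = h + n \<longleftrightarrow> x + s = h" for s
        by (simp only: add.assoc add.commute[of n]) (simp only: add.assoc[symmetric] add_right_cancel)
      then show ?thesis
        using cover[OF gap_add_mem_reduced_apery[OF less.prems True]] by auto
    next
      case False
      then have gap: "x + n \<in> gaps S"
        by (simp add: gaps_def)
      have "{y \<in> gaps S. x + n \<le> y} \<subset> {y \<in> gaps S. x \<le> y}"
      proof
        show "{y \<in> gaps S. x + n \<le> y} \<subseteq> {y \<in> gaps S. x \<le> y}"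
          using vec_le_add[of x n] by auto
        show "{y \<in> gaps S. x + n \<le> y} \<noteq> {y \<in> gaps S. x \<le> y}"
          using less.prems n(2) vec_add_le_self_iff[of x n] by blast
      qed
      then have "card {y \<in> gaps S. x + n \<le> y} < card {y \<in> gaps S. x \<le> y}"
        using gns_finite_gaps[OF gns] by (intro psubset_card_mono) auto
      then consider s where "s \<in> S" "x + n + s = h" | "x + n \<in> F"
        using less.IH gap by blast
      then show ?thesis
      proof cases
        case 1
        then show ?thesis
          using gns_add[OF gns n(1)] by (auto simp: add.assoc)
      next
        case 2
        then obtain g where g: "g \<in> F" "x + n + g = h"
          using refl_F by blast
        have "x + (g + n) = x + n + g"
          by (simp add: ac_simps)
        then show ?thesis
          using g F_add by metis
      qed
    qed
  qed
  have below: "x \<le> h" if "x \<in> gaps S" for x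
    using dichotomy[OF that] refl_F[of x] vec_le_add by auto
  have h_PF: "h \<in> pseudo_frobenius S"
    using maximum_gap_pseudo_frobenius[OF h below] .
  have F_PF: "F \<subseteq> pseudo_frobenius S"
  proof
    fix f assume f: "f \<in> F"
    then obtain g where g: "g \<in> F" "f + g = h"
      using refl_F by blast
    have "f + s \<in> S" if s: "s \<in> S - {0}" for s
    proof (rule ccontr)
      assume "f + s \<notin> S"
      then consider s' where "s' \<in> S" "f + s + s' = h" | "f + s \<in> F"
        using dichotomy[of "f + s"] by (auto simp: gaps_def)
      then show False
      proof cases
        case 1
        then have "f + (s + s') = f + g"
          using g by (simp add: add.assoc)
        then have "g = s + s'"
          by simp
        then show False
          using 1 s g gns_add[OF gns] gaps_F by (auto simp: gaps_def)
      next
        case 2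
        then show False
          using incomparable f s by blast
      qed
    qed
    then show "f \<in> pseudo_frobenius S"
      using f gaps_F by (auto simp: pseudo_frobenius_def)
  qed
  have "pseudo_frobenius S \<subseteq> insert h F"
  proof
    fix f assume f: "f \<in> pseudo_frobenius S"
    have "f = h" if "s \<in> S" "f + s = h" for s
      using that f h by (cases "s = 0") (auto simp: pseudo_frobenius_def gaps_def)
    then show "f \<in> insert h F"
      using dichotomy[of f] f by (auto simp: pseudo_frobenius_def)
  qed
  then show "pseudo_frobenius S = insert h F"
    using F_PF h_PF by blast
  show "reflecting_gap S h"
    using h below dichotomy F_PF by (auto simp: reflecting_gap_def)
  show "h \<notin> F"
    using refl_F[of h] gaps_F gns_zero[OF gns] by (auto simp: gaps_def)
qed


section \<open>Arrangements of the reduced Apery set\<close>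

theorem theorem3p14:
  fixes S :: "(nat ^ 'd) set" and n :: "nat ^ 'd"
    and prec :: "nat ^ 'd \<Rightarrow> nat ^ 'd \<Rightarrow> bool" (infix "\<prec>" 50)
    and t :: nat
  assumes "gns S" and "n \<in> S" and "n \<noteq> 0"
    and "monomial_order (\<prec>)"
    and "t \<ge> 1"
  shows "almost_symmetric S \<and> gns_type S = t \<longleftrightarrow>
    (\<exists>(m :: nat) (a :: nat \<Rightarrow> nat ^ 'd) (b :: nat \<Rightarrow> nat ^ 'd).
       reduced_apery S n = a ` {0..m} \<union> b ` {1..t - 1} \<and>
       a 0 = 0 \<and>
       monotone_on {0..m} (<) (\<prec>) a \<and>
       monotone_on {1..t - 1} (<) (\<prec>) b \<and>
       (t \<ge> 2 \<longrightarrow> b (t - 1) \<prec> a m) \<and>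
       (\<forall>i\<in>{1..t - 1}. to_Z (b i) - to_Z n \<in> range to_Z) \<and>
       (\<forall>i\<in>{1..t - 1}. \<forall>j\<in>{1..t - 1}. i \<noteq> j \<longrightarrow> \<not> le_sg S (to_Z (b i)) (to_Z (b j))) \<and>
       (\<forall>i\<in>{0..m}. a i + a (m - i) = a m) \<and>
       (\<forall>j\<in>{1..t - 1}. b j + b (t - j) = a m + n))"
proof -
  note monomial = \<open>monomial_order (\<prec>)\<close>
  have b_cond: "to_Z x - to_Z n \<in> range to_Z \<longleftrightarrow> (\<exists>f. x = f + n)" for x
    by (simp add: to_Z_diff_mem_image_iff)
  have le_cond: "le_sg S (to_Z x) (to_Z y) \<longleftrightarrow> (\<exists>s\<in>S. y = s + x)" for x y
    by (simp add: le_sg_def to_Z_diff_mem_image_iff)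
  show ?thesis
    unfolding b_cond le_cond almost_symmetric_iff_reflecting_gap[OF \<open>gns S\<close>]
  proof (intro iffI; (elim conjE exE)?)
    fix h assume h: "reflecting_gap S h" and type: "gns_type S = t"
    define F where "F = pseudo_frobenius S - {h}"
    define A where "A = reduced_apery S n - (\<lambda>f. f + n) ` F"
    have h_gap: "h \<in> gaps S"
      using h by (simp add: reflecting_gap_def)
    have fin: "finite F" "finite A"
    proof -
      show "finite F"
        using gns_finite_gaps[OF \<open>gns S\<close>] by (simp add: F_def pseudo_frobenius_def)
      have "A \<subseteq> {..h + n}"
        using h by (auto simp: A_def reflecting_gap_reduced_apery_iff)
      then show "finite A"
        using finite_vec_atMost finite_subset by blast
    qed
    have F_gap: "f \<in> gaps S" if "f \<in> F" for f
      using that by (simp add: F_def pseudo_frobenius_def)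
    have F_add: "f + s \<in> S" if "f \<in> F" "s \<in> S" "s \<noteq> 0" for f s
      using that by (simp add: F_def pseudo_frobenius_def)
    have card_F: "card ((\<lambda>f. f + n) ` F) = t - 1"
    proof -
      have "h \<in> pseudo_frobenius S"
        using h maximum_gap_pseudo_frobenius by (auto simp: reflecting_gap_def)
      then show ?thesis
        using type by (simp add: card_image inj_on_def F_def gns_type_def)
    qed
    have zero_A: "0 \<in> A"
      using gns_zero[OF \<open>gns S\<close>] \<open>n \<noteq> 0\<close> vec_le_add[of 0 "h + n"] h
      by (auto simp: A_def reflecting_gap_reduced_apery_iff vec_add_eq_0_iff
          eq_commute[of "0 :: nat ^ 'd"])
    obtain a where a: "a ` {..<card A} = A" "monotone_on {..<card A} (<) (\<prec>) a"
      using ex_increasing_enumeration[OF monomial fin(2)] by blast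
    obtain e where e: "e ` {..<t - 1} = (\<lambda>f. f + n) ` F" "monotone_on {..<t - 1} (<) (\<prec>) e"
      using ex_increasing_enumeration[OF monomial finite_imageI[OF fin(1)]] card_F by metis
    \<comment> \<open>The \<open>b\<close>'s are numbered from 1, the enumeration \<open>e\<close> from 0.\<close>
    define m where "m = card A - 1"
    define b where "b j = e (j - 1)" for j
    have "card A \<noteq> 0"
      using zero_A fin(2) by auto
    then have card_A: "card A = Suc m"
      by (simp add: m_def)
    have a_refl: "a i + a (m - i) = h + n" if "i \<le> m" for i
      using increasing_enumeration_reflects[OF monomial a, of "h + n" i] that card_A
        reflecting_gap_reflects_reduced_apery[OF \<open>gns S\<close> h \<open>n \<in> S\<close> F_def]
      by (simp add: A_def)
    have "a 0 = 0"
    proof -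
      obtain i where i: "i < card A" "a i = 0"
        using zero_A a(1) by force
      have "i = 0"
      proof (rule ccontr)
        assume "i \<noteq> 0"
        then have "a 0 \<prec> 0"
          using monotone_onD[OF a(2), of 0 i] i by auto
        then show False
          using zero_prec[OF monomial] prec_irrefl[OF monomial] prec_trans[OF monomial] by metis
      qed
      then show ?thesis
        using i by simp
    qed
    then have a_m: "a m = h + n"
      using a_refl[of 0] by simp
    have e_refl: "e i + e (t - 1 - Suc i) = h + n + n" if "i < t - 1" for i
    proof (rule increasing_enumeration_reflects[OF monomial e _ that])
      fix x assume "x \<in> (\<lambda>f. f + n) ` F"
      then obtain f where f: "f \<in> F" "x = f + n"
        by blast
      then obtain g where g: "g \<in> F" "f + g = h"
        using reflecting_gap_reflects_pseudo_frobenius[OF \<open>gns S\<close> h] F_def by blast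
      have "x + (g + n) = f + g + n + n"
        using f by (simp add: ac_simps)
      then show "\<exists>y\<in>(\<lambda>f. f + n) ` F. x + y = h + n + n"
        using g by auto
    qed
    have b_img: "b ` {1..t - 1} = (\<lambda>f. f + n) ` F"
      unfolding image_Suc_lessThan[symmetric] using e(1) by (simp add: b_def image_image)
    then have b_F: "\<exists>f\<in>F. b j = f + n" if "j \<in> {1..t - 1}" for j
      using that by blast
    have b_mono: "monotone_on {1..t - 1} (<) (\<prec>) b"
      using e(2) by (auto simp: monotone_on_def b_def)
    have a_mono: "monotone_on {0..m} (<) (\<prec>) a"
      using a(2) by (auto simp: monotone_on_def card_A)
    have "reduced_apery S n = a ` {0..m} \<union> b ` {1..t - 1}"
    proof -
      have "f + n \<in> reduced_apery S n" if "f \<in> F" for f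
        using gap_add_mem_reduced_apery F_gap F_add that \<open>n \<in> S\<close> \<open>n \<noteq> 0\<close> by blast
      moreover have "a ` {0..m} = A"
        using a(1) by (simp add: card_A lessThan_Suc_atMost atLeast0AtMost)
      ultimately show ?thesis
        unfolding b_img by (auto simp: A_def)
    qed
    moreover have "t \<ge> 2 \<longrightarrow> b (t - 1) \<prec> a m"
    proof
      assume t: "t \<ge> 2"
      have "t - 1 \<in> {1..t - 1}"
        using t by auto
      then obtain f where f: "f \<in> F" "b (t - 1) = f + n"
        using b_F by blast
      then have "f \<le> h" "f \<noteq> h"
        using h F_gap by (auto simp: reflecting_gap_def F_def)
      then have "f \<prec> h"
        using prec_of_le[OF monomial] by blast
      then show "b (t - 1) \<prec> a m"
        using f a_m prec_add_right[OF monomial] by simp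
    qed
    moreover have "\<forall>i\<in>{1..t - 1}. \<forall>j\<in>{1..t - 1}. i \<noteq> j \<longrightarrow> \<not> (\<exists>s\<in>S. b j = s + b i)"
    proof (intro ballI impI notI)
      fix i j assume ij: "i \<in> {1..t - 1}" "j \<in> {1..t - 1}" "i \<noteq> j"
      assume "\<exists>s\<in>S. b j = s + b i"
      then obtain s where s: "s \<in> S" "b j = s + b i"
        by blast
      obtain f g where fg: "f \<in> F" "b i = f + n" "g \<in> F" "b j = g + n"
        using b_F ij by meson
      have "b i \<noteq> b j"
        using monotone_on_imp_inj_on[OF monomial b_mono] ij by (auto dest: inj_onD)
      moreover have "g + n = f + s + n"
        using s fg by (simp add: ac_simps)
      then have "g = f + s"
        by simp
      ultimately have "g \<in> S"
        using s fg F_add[of f s] by (cases "s = 0") auto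
      then show False
        using F_gap[OF \<open>g \<in> F\<close>] by (simp add: gaps_def)
    qed
    moreover have "\<forall>j\<in>{1..t - 1}. b j + b (t - j) = a m + n"
    proof
      fix j assume j: "j \<in> {1..t - 1}"
      then have "t - 1 - Suc (j - 1) = t - j - 1" "j - 1 < t - 1"
        by auto
      then show "b j + b (t - j) = a m + n"
        using e_refl[of "j - 1"] a_m by (simp add: b_def)
    qed
    moreover have "\<forall>i\<in>{0..m}. a i + a (m - i) = a m"
      using a_refl a_m by simp
    moreover have "\<forall>i\<in>{1..t - 1}. \<exists>f. b i = f + n"
      using b_F by blast
    ultimately show "\<exists>(m :: nat) a b. reduced_apery S n = a ` {0..m} \<union> b ` {1..t - 1} \<and>
       a 0 = 0 \<and>
       monotone_on {0..m} (<) (\<prec>) a \<and>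
       monotone_on {1..t - 1} (<) (\<prec>) b \<and>
       (t \<ge> 2 \<longrightarrow> b (t - 1) \<prec> a m) \<and>
       (\<forall>i\<in>{1..t - 1}. \<exists>f. b i = f + n) \<and>
       (\<forall>i\<in>{1..t - 1}. \<forall>j\<in>{1..t - 1}. i \<noteq> j \<longrightarrow> \<not> (\<exists>s\<in>S. b j = s + b i)) \<and>
       (\<forall>i\<in>{0..m}. a i + a (m - i) = a m) \<and>
       (\<forall>j\<in>{1..t - 1}. b j + b (t - j) = a m + n)"
      using \<open>a 0 = 0\<close> a_mono b_mono
      by - (rule exI[of _ m], rule exI[of _ a], rule exI[of _ b], intro conjI; assumption)
  next
    fix m :: nat and a b
    assume C: "reduced_apery S n = a ` {0..m} \<union> b ` {1..t - 1}"
      and "a 0 = 0"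
      and a_mono: "monotone_on {0..m} (<) (\<prec>) a"
      and b_mono: "monotone_on {1..t - 1} (<) (\<prec>) b"
      and b_last: "t \<ge> 2 \<longrightarrow> b (t - 1) \<prec> a m"
      and b_shift: "\<forall>i\<in>{1..t - 1}. \<exists>f. b i = f + n"
      and b_incomparable:
        "\<forall>i\<in>{1..t - 1}. \<forall>j\<in>{1..t - 1}. i \<noteq> j \<longrightarrow> \<not> (\<exists>s\<in>S. b j = s + b i)"
      and a_refl: "\<forall>i\<in>{0..m}. a i + a (m - i) = a m"
      and b_refl: "\<forall>j\<in>{1..t - 1}. b j + b (t - j) = a m + n"
    have a_C: "a i \<in> reduced_apery S n" if "i \<in> {0..m}" for i
      using C that by blast
    have b_C: "b i \<in> reduced_apery S n" if "i \<in> {1..t - 1}" for i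
      using C that by blast
    have max: "c \<prec> a m \<or> c = a m" if "c \<in> reduced_apery S n" for c
    proof -
      consider i where "i \<in> {0..m}" "c = a i" | i where "i \<in> {1..t - 1}" "c = b i"
        using \<open>c \<in> reduced_apery S n\<close> C by blast
      then show ?thesis
      proof cases
        case 1
        then show ?thesis
          using a_mono by (cases "i = m") (auto simp: monotone_on_def)
      next
        case 2
        then have "b i \<prec> b (t - 1) \<or> b i = b (t - 1)"
          using b_mono by (cases "i = t - 1") (auto simp: monotone_on_def)
        then show ?thesis
          using 2 b_last prec_trans[OF monomial] by auto
      qed
    qed
    obtain x where x: "x \<in> gaps S" "a m \<le> x + n"
      using a_C[of m] by (auto simp: reduced_apery_iff)
    obtain h where h: "h \<in> gaps S" and h_max: "\<And>y. y \<in> gaps S \<Longrightarrow> y \<prec> h \<or> y = h"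
      using ex_prec_maximum[OF monomial gns_finite_gaps[OF \<open>gns S\<close>]] x(1) by blast
    \<comment> \<open>Since \<open>h + n\<close> exceeds the largest gap \<open>h\<close>, it lies in the reduced Apery set, of which
      \<open>a m\<close> is the largest element; and \<open>a m\<close> is below some gap plus \<open>n\<close>.\<close>
    have a_m: "a m = h + n"
    proof -
      have "h \<prec> h + n"
        using prec_add_right[OF monomial zero_prec[OF monomial \<open>n \<noteq> 0\<close>], of h]
        by (simp add: add.commute)
      then have "h + n \<in> S"
        using h_max[of "h + n"] prec_trans[OF monomial] prec_irrefl[OF monomial]
        by (fastforce simp: gaps_def)
      then have "h + n \<prec> a m \<or> h + n = a m"
        using max gap_add_mem_reduced_apery[OF h] by blast
      moreover have "a m \<prec> x + n \<or> a m = x + n"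
        using prec_of_le[OF monomial x(2)] .
      moreover have "x + n \<prec> h + n \<or> x + n = h + n"
        using h_max[OF x(1)] prec_add_right[OF monomial] by blast
      ultimately show ?thesis
        using prec_trans[OF monomial] prec_irrefl[OF monomial] by metis
    qed
    obtain f where f: "b i = f i + n" if "i \<in> {1..t - 1}" for i
      using b_shift by metis
    define F where "F = f ` {1..t - 1}"
    have refl_f: "f i + f (t - i) = h" if "i \<in> {1..t - 1}" for i
    proof -
      have "t - i \<in> {1..t - 1}"
        using that by auto
      then have "f i + n + (f (t - i) + n) = h + n + n"
        using b_refl a_m f that by metis
      then have "f i + f (t - i) + (n + n) = h + (n + n)"
        by (simp add: ac_simps)
      then show ?thesis
        by simp
    qed
    have inj: "inj_on f {1..t - 1}"
      using monotone_on_imp_inj_on[OF monomial b_mono] f by (auto simp: inj_on_def)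
    have cover: "(\<exists>s\<in>S. c + s = h + n) \<or> (\<exists>f\<in>F. c = f + n)" if "c \<in> reduced_apery S n" for c
    proof -
      consider i where "i \<in> {0..m}" "c = a i" | i where "i \<in> {1..t - 1}" "c = b i"
        using \<open>c \<in> reduced_apery S n\<close> C by blast
      then show ?thesis
      proof cases
        case 1
        then have "c + a (m - i) = h + n"
          using a_refl a_m by metis
        moreover have "a (m - i) \<in> S"
          using a_C[of "m - i"] by (simp add: reduced_apery_iff)
        ultimately show ?thesis
          by blast
      next
        case 2
        then show ?thesis
          using f by (auto simp: F_def)
      qed
    qed
    have F_gap: "F \<subseteq> gaps S"
      using b_C f by (force simp: F_def gaps_def reduced_apery_iff)
    have F_add: "g + n \<in> S" if "g \<in> F" for g
      using that b_C f by (force simp: F_def reduced_apery_iff)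
    have refl_F: "\<exists>g'\<in>F. g + g' = h" if "g \<in> F" for g
    proof -
      obtain i where i: "i \<in> {1..t - 1}" "g = f i"
        using \<open>g \<in> F\<close> by (auto simp: F_def)
      then have "t - i \<in> {1..t - 1}"
        by auto
      then have "f (t - i) \<in> F"
        unfolding F_def by (rule imageI)
      then show ?thesis
        using i refl_f by blast
    qed
    have incomparable: "s = 0" if gs: "g \<in> F" "s \<in> S" "g + s \<in> F" for g s
    proof -
      obtain i j where ij: "i \<in> {1..t - 1}" "g = f i" "j \<in> {1..t - 1}" "g + s = f j"
        using gs by (auto simp: F_def)
      then have "b j = g + s + n" "b i = g + n"
        using f by simp_all
      then have "b j = s + b i"
        by (simp add: ac_simps)
      then have "i = j"
        using b_incomparable ij gs by blast
      then show ?thesis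
        using ij by simp
    qed
    have result: "reflecting_gap S h" "pseudo_frobenius S = insert h F" "h \<notin> F"
      by (rule_tac [!] reflecting_gap_of_reduced_apery_cover
            [where F = F, OF \<open>gns S\<close> \<open>n \<in> S\<close> \<open>n \<noteq> 0\<close> h])
        (fact cover F_gap F_add refl_F incomparable)+
    have "card F = t - 1" "finite F"
      using card_image[OF inj] by (simp_all add: F_def)
    then have "gns_type S = t"
      using result(3) \<open>t \<ge> 1\<close> by (simp add: gns_type_def result(2))
    then show "(\<exists>h. reflecting_gap S h) \<and> gns_type S = t"
      using result(1) by blast
  qed
qed

end
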